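(* Let $\mathrm{Cont}=\mathtt{where}\{\mathtt{return}\,x=\lambda c.\,c!\,x;\ m\gg\!=f=\lambda c.\,m!\,\{\lambda y.\,f!\,y\,c\}\}$. Let $M\mapsto M^*$ be the translation from the untyped effect handler calculus to the untyped monadic reflection calculus that is homomorphic on all core constructs and satisfies $(\mathit{op}\,V)^*=\mathtt{reflect}(\lambda k.\lambda h.\,h!\,(\mathit{op}\,(V^*,\{\lambda y.\,k!\,y\,h\})))$ (using the operation name $\mathit{op}$ as a variant label) and, for $H=\{\mathtt{return}\,x\mapsto N_{\mathrm{ret}}\}\uplus\{\mathit{op}_i\,p_i\,k_i\mapsto N_i\}_{i=1}^n$, $(\mathtt{handle}\,M\,\mathtt{with}\,H)^*=(\mathtt{reify}_{\mathrm{Cont}}\,M^* )\,\{\lambda x.\lambda h.N_{\mathrm{ret}}^*\}\,\{\lambda y.\,\mathtt{case}\,y\,\mathtt{of}\,\{\mathit{op}_i\,(p_i,k_i)\mapsto N_i^*\}_{i=1}^n\}$ (with $h,k,y$ fresh and nested patterns desugared to $\mathtt{let}\,(p_i,k_i)=\cdot\,\mathtt{in}$). Then for all computations $M,N$ of the effect handler calculus, $M\to N$ implies $M^*\rightsquigarrow^{+}N^*$.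
   Context: Core syntax (shared). Values $V ::= x \mid () \mid (V_1,V_2) \mid \ell\,V \mid \{M\}$; computations $M,N ::= \mathtt{let}\,(x,y)=V\,\mathtt{in}\,M \mid \mathtt{case}\,V\,\mathtt{of}\,\{\ell_i x_i\mapsto M_i\}_i \mid V! \mid \mathtt{return}\,V \mid \mathtt{let}\,x\Leftarrow M\,\mathtt{in}\,N \mid \lambda x.M \mid M\,V \mid \langle M_1,M_2\rangle \mid \mathrm{prj}_i M$. Core $\beta$-rules: $\mathtt{let}\,(x,y)=(V_1,V_2)\,\mathtt{in}\,M \to_\beta M[V_1/x,V_2/y]$; $\mathtt{case}\,\ell_j V\,\mathtt{of}\,\{\dots\ell_j x_j\mapsto M_j\dots\}\to_\beta M_j[V/x_j]$; $\{M\}!\to_\beta M$; $\mathtt{let}\,x\Leftarrow\mathtt{return}\,V\,\mathtt{in}\,N\to_\beta N[V/x]$; $(\lambda x.M)V\to_\beta M[V/x]$; $\mathrm{prj}_i\langle M_1,M_2\rangle\to_\beta M_i$. Basic frames $B ::= \mathtt{let}\,x\Leftarrow[\,]\,\mathtt{in}\,N\mid[\,]\,V\mid\mathrm{prj}_i[\,]$; hoisting contexts $\mathcal{H}::=[\,]\mid\mathcal{H}[B]$. In each calculus $M\to N$ iff $M=K[M']$, $N=K[N']$ with $M'\to_\beta N'$ and $K$ an evaluation context of that calculus. Effect handler calculus: operation names $\mathit{op}$; adds computations $\mathit{op}\,V$ and $\mathtt{handle}\,M\,\mathtt{with}\,H$, where $H$ has a return clause $\mathtt{return}\,x\mapsto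 N_{\mathrm{ret}}$ and operation clauses $\mathit{op}\,p\,k\mapsto N_{\mathit{op}}$ for $\mathit{op}$ in a finite set $\mathrm{ops}(H)$; evaluation contexts $K::=[\,]\mid K[B]\mid K[\mathtt{handle}\,[\,]\,\mathtt{with}\,H]$; extra rules $\mathtt{handle}\,(\mathtt{return}\,V)\,\mathtt{with}\,H\to_\beta N_{\mathrm{ret}}[V/x]$ and $\mathtt{handle}\,\mathcal{H}[\mathit{op}\,V]\,\mathtt{with}\,H\to_\beta N_{\mathit{op}}[V/p,\{\lambda y.\mathtt{handle}\,\mathcal{H}[\mathtt{return}\,y]\,\mathtt{with}\,H\}/k]$ for $\mathit{op}\in\mathrm{ops}(H)$. Monadic reflection calculus: monad terms $T=\mathtt{where}\{\mathtt{return}\,x=N_u;\ y\gg\!=f=N_b\}$; adds computations $\mathtt{reflect}\,N$ and $\mathtt{reify}_T\,M$; evaluation contexts $K::=[\,]\mid K[B]\mid K[\mathtt{reify}_T[\,]]$; extra rules $\mathtt{reify}_T(\mathtt{return}\,V)\to_\beta N_u[V/x]$ and $\mathtt{reify}_T\,\mathcal{H}[\mathtt{reflect}\,N]\to_\beta N_b[\{N\}/y,\{\lambda z.\mathtt{reify}_T\,\mathcal{H}[\mathtt{return}\,z]\}/f]$. $\rightsquigarrow$ is the smallest relation on target terms containing $\to_\beta$ and closed under all term-forming constructs; $\rightsquigarrow^{+}$ is its transitive closure. *)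

theory Defs
  imports "HOL-Library.Finite_Map"
begin

text \<open>
  Both calculi are represented with de Bruijn indices, so terms are taken up to
  renaming of bound variables. Index 0 refers to the innermost binder. A construct that binds
  two variables binds its first variable as index 1 and its second one as index 0.

  Variant labels and operation names are drawn from the same type \<open>'l\<close>, since the translation
  uses operation names as variant labels. Finite families of clauses are finite maps.
\<close>

section \<open>The effect handler calculus\<close>

datatype 'l hval =
    HVar nat
  | HUnit
  | HPair "'l hval" "'l hval"
  | HInj 'l "'l hval"
  | HThunk "'l hcomp"
and 'l hcomp =
    HSplit "'l hval" "'l hcomp"                    (* let (x,y) = V in M; x is 1, y is 0 *)
  | HCase "'l hval" "('l, 'l hcomp) fmap"          (* each clause binds 0 *)
  | HForce "'l hval"
  | HReturn "'l hval"
  | HLet "'l hcomp" "'l hcomp"                     (* the second computation binds 0 *)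
  | HLam "'l hcomp"
  | HApp "'l hcomp" "'l hval"
  | HTuple "'l hcomp" "'l hcomp"
  | HPrj1 "'l hcomp"
  | HPrj2 "'l hcomp"
  | HOp 'l "'l hval"
  | HHandle "'l hcomp" "'l handler"
and 'l handler =
    Handler "'l hcomp" "('l, 'l hcomp) fmap"
      (* return clause: x is 0; operation clauses: p is 1, k is 0 *)

definition up_ren :: "(nat \<Rightarrow> nat) \<Rightarrow> nat \<Rightarrow> nat" where
  "up_ren r = case_nat 0 (\<lambda>n. Suc (r n))"

primrec hren_val :: "(nat \<Rightarrow> nat) \<Rightarrow> 'l hval \<Rightarrow> 'l hval"
  and hren :: "(nat \<Rightarrow> nat) \<Rightarrow> 'l hcomp \<Rightarrow> 'l hcomp"
  and hren_handler :: "(nat \<Rightarrow> nat) \<Rightarrow> 'l handler \<Rightarrow> 'l handler" where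
  "hren_val r (HVar n) = HVar (r n)"
| "hren_val r HUnit = HUnit"
| "hren_val r (HPair V W) = HPair (hren_val r V) (hren_val r W)"
| "hren_val r (HInj l V) = HInj l (hren_val r V)"
| "hren_val r (HThunk M) = HThunk (hren r M)"
| "hren r (HSplit V M) = HSplit (hren_val r V) (hren (up_ren (up_ren r)) M)"
| "hren r (HCase V C) = HCase (hren_val r V) (fmmap (\<lambda>M. hren (up_ren r) M) C)"
| "hren r (HForce V) = HForce (hren_val r V)"
| "hren r (HReturn V) = HReturn (hren_val r V)"
| "hren r (HLet M N) = HLet (hren r M) (hren (up_ren r) N)"
| "hren r (HLam M) = HLam (hren (up_ren r) M)"
| "hren r (HApp M V) = HApp (hren r M) (hren_val r V)"
| "hren r (HTuple M N) = HTuple (hren r M) (hren r N)"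
| "hren r (HPrj1 M) = HPrj1 (hren r M)"
| "hren r (HPrj2 M) = HPrj2 (hren r M)"
| "hren r (HOp l V) = HOp l (hren_val r V)"
| "hren r (HHandle M H) = HHandle (hren r M) (hren_handler r H)"
| "hren_handler r (Handler N C) =
     Handler (hren (up_ren r) N) (fmmap (\<lambda>M. hren (up_ren (up_ren r)) M) C)"

definition hup :: "(nat \<Rightarrow> 'l hval) \<Rightarrow> nat \<Rightarrow> 'l hval" where
  "hup s = case_nat (HVar 0) (\<lambda>n. hren_val Suc (s n))"

primrec hsub_val :: "(nat \<Rightarrow> 'l hval) \<Rightarrow> 'l hval \<Rightarrow> 'l hval"
  and hsub :: "(nat \<Rightarrow> 'l hval) \<Rightarrow> 'l hcomp \<Rightarrow> 'l hcomp"
  and hsub_handler :: "(nat \<Rightarrow> 'l hval) \<Rightarrow> 'l handler \<Rightarrow> 'l handler" where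
  "hsub_val s (HVar n) = s n"
| "hsub_val s HUnit = HUnit"
| "hsub_val s (HPair V W) = HPair (hsub_val s V) (hsub_val s W)"
| "hsub_val s (HInj l V) = HInj l (hsub_val s V)"
| "hsub_val s (HThunk M) = HThunk (hsub s M)"
| "hsub s (HSplit V M) = HSplit (hsub_val s V) (hsub (hup (hup s)) M)"
| "hsub s (HCase V C) = HCase (hsub_val s V) (fmmap (\<lambda>M. hsub (hup s) M) C)"
| "hsub s (HForce V) = HForce (hsub_val s V)"
| "hsub s (HReturn V) = HReturn (hsub_val s V)"
| "hsub s (HLet M N) = HLet (hsub s M) (hsub (hup s) N)"
| "hsub s (HLam M) = HLam (hsub (hup s) M)"
| "hsub s (HApp M V) = HApp (hsub s M) (hsub_val s V)"
| "hsub s (HTuple M N) = HTuple (hsub s M) (hsub s N)"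
| "hsub s (HPrj1 M) = HPrj1 (hsub s M)"
| "hsub s (HPrj2 M) = HPrj2 (hsub s M)"
| "hsub s (HOp l V) = HOp l (hsub_val s V)"
| "hsub s (HHandle M H) = HHandle (hsub s M) (hsub_handler s H)"
| "hsub_handler s (Handler N C) =
     Handler (hsub (hup s) N) (fmmap (\<lambda>M. hsub (hup (hup s)) M) C)"

definition hinst1 :: "'l hval \<Rightarrow> 'l hcomp \<Rightarrow> 'l hcomp" where
  "hinst1 V M = hsub (case_nat V HVar) M"

text \<open>\<open>hinst2 V W M\<close> simultaneously replaces index 1 by \<open>V\<close> and index 0 by \<open>W\<close>.\<close>

definition hinst2 :: "'l hval \<Rightarrow> 'l hval \<Rightarrow> 'l hcomp \<Rightarrow> 'l hcomp" where
  "hinst2 V W M = hsub (case_nat W (case_nat V HVar)) M"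

datatype 'l hframe =
    HFLet "'l hcomp"
  | HFApp "'l hval"
  | HFPrj1
  | HFPrj2

primrec hplug_frame :: "'l hframe \<Rightarrow> 'l hcomp \<Rightarrow> 'l hcomp" where
  "hplug_frame (HFLet N) M = HLet M N"
| "hplug_frame (HFApp V) M = HApp M V"
| "hplug_frame HFPrj1 M = HPrj1 M"
| "hplug_frame HFPrj2 M = HPrj2 M"

primrec hren_frame :: "(nat \<Rightarrow> nat) \<Rightarrow> 'l hframe \<Rightarrow> 'l hframe" where
  "hren_frame r (HFLet N) = HFLet (hren (up_ren r) N)"
| "hren_frame r (HFApp V) = HFApp (hren_val r V)"
| "hren_frame r HFPrj1 = HFPrj1"
| "hren_frame r HFPrj2 = HFPrj2"

datatype 'l hhoist =
    HHole
  | HHExt "'l hhoist" "'l hframe"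

primrec hplug_hoist :: "'l hhoist \<Rightarrow> 'l hcomp \<Rightarrow> 'l hcomp" where
  "hplug_hoist HHole M = M"
| "hplug_hoist (HHExt X B) M = hplug_hoist X (hplug_frame B M)"

primrec hren_hoist :: "(nat \<Rightarrow> nat) \<Rightarrow> 'l hhoist \<Rightarrow> 'l hhoist" where
  "hren_hoist r HHole = HHole"
| "hren_hoist r (HHExt X B) = HHExt (hren_hoist r X) (hren_frame r B)"

datatype 'l hctx =
    HKHole
  | HKFrame "'l hctx" "'l hframe"
  | HKHandle "'l hctx" "'l handler"

primrec hplug :: "'l hctx \<Rightarrow> 'l hcomp \<Rightarrow> 'l hcomp" where
  "hplug HKHole M = M"
| "hplug (HKFrame K B) M = hplug K (hplug_frame B M)"
| "hplug (HKHandle K H) M = hplug K (HHandle M H)"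

text \<open>
  In \<open>hbeta_op\<close> the captured continuation is placed under the binder \<open>\<lambda>y\<close>, hence the
  renaming of the hoisting context and of the handler by \<open>Suc\<close>.
\<close>

inductive hbeta :: "'l hcomp \<Rightarrow> 'l hcomp \<Rightarrow> bool" where
  hbeta_split: "hbeta (HSplit (HPair V W) M) (hinst2 V W M)"
| hbeta_case: "fmlookup C l = Some M \<Longrightarrow> hbeta (HCase (HInj l V) C) (hinst1 V M)"
| hbeta_force: "hbeta (HForce (HThunk M)) M"
| hbeta_let: "hbeta (HLet (HReturn V) N) (hinst1 V N)"
| hbeta_app: "hbeta (HApp (HLam M) V) (hinst1 V M)"
| hbeta_prj1: "hbeta (HPrj1 (HTuple M N)) M"
| hbeta_prj2: "hbeta (HPrj2 (HTuple M N)) N"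
| hbeta_ret: "hbeta (HHandle (HReturn V) (Handler N C)) (hinst1 V N)"
| hbeta_op: "fmlookup C l = Some M \<Longrightarrow> H = Handler N C \<Longrightarrow>
    hbeta (HHandle (hplug_hoist X (HOp l V)) H)
      (hinst2 V
        (HThunk (HLam (HHandle (hplug_hoist (hren_hoist Suc X) (HReturn (HVar 0)))
                               (hren_handler Suc H))))
        M)"

inductive hstep :: "'l hcomp \<Rightarrow> 'l hcomp \<Rightarrow> bool" where
  "hbeta M N \<Longrightarrow> hstep (hplug K M) (hplug K N)"

section \<open>The monadic reflection calculus\<close>

datatype 'l mval =
    MVar nat
  | MUnit
  | MPair "'l mval" "'l mval"
  | MInj 'l "'l mval"
  | MThunk "'l mcomp"
and 'l mcomp =
    MSplit "'l mval" "'l mcomp"                    (* let (x,y) = V in M; x is 1, y is 0 *)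
  | MCase "'l mval" "('l, 'l mcomp) fmap"          (* each clause binds 0 *)
  | MForce "'l mval"
  | MReturn "'l mval"
  | MLet "'l mcomp" "'l mcomp"                     (* the second computation binds 0 *)
  | MLam "'l mcomp"
  | MApp "'l mcomp" "'l mval"
  | MTuple "'l mcomp" "'l mcomp"
  | MPrj1 "'l mcomp"
  | MPrj2 "'l mcomp"
  | MReflect "'l mcomp"
  | MReify "'l monad" "'l mcomp"
and 'l monad =
    Where "'l mcomp" "'l mcomp"
      (* unit: x is 0; bind: y is 1, f is 0 *)

primrec mren_val :: "(nat \<Rightarrow> nat) \<Rightarrow> 'l mval \<Rightarrow> 'l mval"
  and mren :: "(nat \<Rightarrow> nat) \<Rightarrow> 'l mcomp \<Rightarrow> 'l mcomp"
  and mren_monad :: "(nat \<Rightarrow> nat) \<Rightarrow> 'l monad \<Rightarrow> 'l monad" where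
  "mren_val r (MVar n) = MVar (r n)"
| "mren_val r MUnit = MUnit"
| "mren_val r (MPair V W) = MPair (mren_val r V) (mren_val r W)"
| "mren_val r (MInj l V) = MInj l (mren_val r V)"
| "mren_val r (MThunk M) = MThunk (mren r M)"
| "mren r (MSplit V M) = MSplit (mren_val r V) (mren (up_ren (up_ren r)) M)"
| "mren r (MCase V C) = MCase (mren_val r V) (fmmap (\<lambda>M. mren (up_ren r) M) C)"
| "mren r (MForce V) = MForce (mren_val r V)"
| "mren r (MReturn V) = MReturn (mren_val r V)"
| "mren r (MLet M N) = MLet (mren r M) (mren (up_ren r) N)"
| "mren r (MLam M) = MLam (mren (up_ren r) M)"
| "mren r (MApp M V) = MApp (mren r M) (mren_val r V)"
| "mren r (MTuple M N) = MTuple (mren r M) (mren r N)"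
| "mren r (MPrj1 M) = MPrj1 (mren r M)"
| "mren r (MPrj2 M) = MPrj2 (mren r M)"
| "mren r (MReflect N) = MReflect (mren r N)"
| "mren r (MReify T M) = MReify (mren_monad r T) (mren r M)"
| "mren_monad r (Where Nu Nb) = Where (mren (up_ren r) Nu) (mren (up_ren (up_ren r)) Nb)"

definition mup :: "(nat \<Rightarrow> 'l mval) \<Rightarrow> nat \<Rightarrow> 'l mval" where
  "mup s = case_nat (MVar 0) (\<lambda>n. mren_val Suc (s n))"

primrec msub_val :: "(nat \<Rightarrow> 'l mval) \<Rightarrow> 'l mval \<Rightarrow> 'l mval"
  and msub :: "(nat \<Rightarrow> 'l mval) \<Rightarrow> 'l mcomp \<Rightarrow> 'l mcomp"
  and msub_monad :: "(nat \<Rightarrow> 'l mval) \<Rightarrow> 'l monad \<Rightarrow> 'l monad" where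
  "msub_val s (MVar n) = s n"
| "msub_val s MUnit = MUnit"
| "msub_val s (MPair V W) = MPair (msub_val s V) (msub_val s W)"
| "msub_val s (MInj l V) = MInj l (msub_val s V)"
| "msub_val s (MThunk M) = MThunk (msub s M)"
| "msub s (MSplit V M) = MSplit (msub_val s V) (msub (mup (mup s)) M)"
| "msub s (MCase V C) = MCase (msub_val s V) (fmmap (\<lambda>M. msub (mup s) M) C)"
| "msub s (MForce V) = MForce (msub_val s V)"
| "msub s (MReturn V) = MReturn (msub_val s V)"
| "msub s (MLet M N) = MLet (msub s M) (msub (mup s) N)"
| "msub s (MLam M) = MLam (msub (mup s) M)"
| "msub s (MApp M V) = MApp (msub s M) (msub_val s V)"
| "msub s (MTuple M N) = MTuple (msub s M) (msub s N)"
| "msub s (MPrj1 M) = MPrj1 (msub s M)"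
| "msub s (MPrj2 M) = MPrj2 (msub s M)"
| "msub s (MReflect N) = MReflect (msub s N)"
| "msub s (MReify T M) = MReify (msub_monad s T) (msub s M)"
| "msub_monad s (Where Nu Nb) = Where (msub (mup s) Nu) (msub (mup (mup s)) Nb)"

definition minst1 :: "'l mval \<Rightarrow> 'l mcomp \<Rightarrow> 'l mcomp" where
  "minst1 V M = msub (case_nat V MVar) M"

definition minst2 :: "'l mval \<Rightarrow> 'l mval \<Rightarrow> 'l mcomp \<Rightarrow> 'l mcomp" where
  "minst2 V W M = msub (case_nat W (case_nat V MVar)) M"

datatype 'l mframe =
    MFLet "'l mcomp"
  | MFApp "'l mval"
  | MFPrj1
  | MFPrj2

primrec mplug_frame :: "'l mframe \<Rightarrow> 'l mcomp \<Rightarrow> 'l mcomp" where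
  "mplug_frame (MFLet N) M = MLet M N"
| "mplug_frame (MFApp V) M = MApp M V"
| "mplug_frame MFPrj1 M = MPrj1 M"
| "mplug_frame MFPrj2 M = MPrj2 M"

primrec mren_frame :: "(nat \<Rightarrow> nat) \<Rightarrow> 'l mframe \<Rightarrow> 'l mframe" where
  "mren_frame r (MFLet N) = MFLet (mren (up_ren r) N)"
| "mren_frame r (MFApp V) = MFApp (mren_val r V)"
| "mren_frame r MFPrj1 = MFPrj1"
| "mren_frame r MFPrj2 = MFPrj2"

datatype 'l mhoist =
    MHole
  | MHExt "'l mhoist" "'l mframe"

primrec mplug_hoist :: "'l mhoist \<Rightarrow> 'l mcomp \<Rightarrow> 'l mcomp" where
  "mplug_hoist MHole M = M"
| "mplug_hoist (MHExt X B) M = mplug_hoist X (mplug_frame B M)"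

primrec mren_hoist :: "(nat \<Rightarrow> nat) \<Rightarrow> 'l mhoist \<Rightarrow> 'l mhoist" where
  "mren_hoist r MHole = MHole"
| "mren_hoist r (MHExt X B) = MHExt (mren_hoist r X) (mren_frame r B)"

inductive mbeta :: "'l mcomp \<Rightarrow> 'l mcomp \<Rightarrow> bool" where
  mbeta_split: "mbeta (MSplit (MPair V W) M) (minst2 V W M)"
| mbeta_case: "fmlookup C l = Some M \<Longrightarrow> mbeta (MCase (MInj l V) C) (minst1 V M)"
| mbeta_force: "mbeta (MForce (MThunk M)) M"
| mbeta_let: "mbeta (MLet (MReturn V) N) (minst1 V N)"
| mbeta_app: "mbeta (MApp (MLam M) V) (minst1 V M)"
| mbeta_prj1: "mbeta (MPrj1 (MTuple M N)) M"
| mbeta_prj2: "mbeta (MPrj2 (MTuple M N)) N"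
| mbeta_ret: "mbeta (MReify (Where Nu Nb) (MReturn V)) (minst1 V Nu)"
| mbeta_reflect: "T = Where Nu Nb \<Longrightarrow>
    mbeta (MReify T (mplug_hoist X (MReflect N)))
      (minst2 (MThunk N)
        (MThunk (MLam (MReify (mren_monad Suc T)
                              (mplug_hoist (mren_hoist Suc X) (MReturn (MVar 0))))))
        Nb)"

text \<open>The relation \<open>\<leadsto>\<close>, on values, computations and monad terms simultaneously.\<close>

inductive mred_val :: "'l mval \<Rightarrow> 'l mval \<Rightarrow> bool"
  and mred :: "'l mcomp \<Rightarrow> 'l mcomp \<Rightarrow> bool"
  and mred_monad :: "'l monad \<Rightarrow> 'l monad \<Rightarrow> bool" where
  "mbeta M N \<Longrightarrow> mred M N"
| "mred_val V V' \<Longrightarrow> mred_val (MPair V W) (MPair V' W)"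
| "mred_val W W' \<Longrightarrow> mred_val (MPair V W) (MPair V W')"
| "mred_val V V' \<Longrightarrow> mred_val (MInj l V) (MInj l V')"
| "mred M M' \<Longrightarrow> mred_val (MThunk M) (MThunk M')"
| "mred_val V V' \<Longrightarrow> mred (MSplit V M) (MSplit V' M)"
| "mred M M' \<Longrightarrow> mred (MSplit V M) (MSplit V M')"
| "mred_val V V' \<Longrightarrow> mred (MCase V C) (MCase V' C)"
| "fmlookup C l = Some M \<Longrightarrow> mred M M' \<Longrightarrow> mred (MCase V C) (MCase V (fmupd l M' C))"
| "mred_val V V' \<Longrightarrow> mred (MForce V) (MForce V')"
| "mred_val V V' \<Longrightarrow> mred (MReturn V) (MReturn V')"
| "mred M M' \<Longrightarrow> mred (MLet M N) (MLet M' N)"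
| "mred N N' \<Longrightarrow> mred (MLet M N) (MLet M N')"
| "mred M M' \<Longrightarrow> mred (MLam M) (MLam M')"
| "mred M M' \<Longrightarrow> mred (MApp M V) (MApp M' V)"
| "mred_val V V' \<Longrightarrow> mred (MApp M V) (MApp M V')"
| "mred M M' \<Longrightarrow> mred (MTuple M N) (MTuple M' N)"
| "mred N N' \<Longrightarrow> mred (MTuple M N) (MTuple M N')"
| "mred M M' \<Longrightarrow> mred (MPrj1 M) (MPrj1 M')"
| "mred M M' \<Longrightarrow> mred (MPrj2 M) (MPrj2 M')"
| "mred N N' \<Longrightarrow> mred (MReflect N) (MReflect N')"
| "mred_monad T T' \<Longrightarrow> mred (MReify T M) (MReify T' M)"
| "mred M M' \<Longrightarrow> mred (MReify T M) (MReify T M')"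
| "mred Nu Nu' \<Longrightarrow> mred_monad (Where Nu Nb) (Where Nu' Nb)"
| "mred Nb Nb' \<Longrightarrow> mred_monad (Where Nu Nb) (Where Nu Nb')"

section \<open>The translation\<close>

text \<open>
  \<open>return x = \<lambda>c. c! x\<close> and \<open>m >>= f = \<lambda>c. m! {\<lambda>y. f! y c}\<close>. In the second equation \<open>m\<close> and \<open>f\<close> are
  2 and 1 under \<open>\<lambda>c\<close>, and \<open>f\<close> and \<open>c\<close> are 2 and 1 under \<open>\<lambda>y\<close>.
\<close>
definition Cont :: "'l monad" where
  "Cont = Where
     (MLam (MApp (MForce (MVar 0)) (MVar 1)))
     (MLam (MApp (MForce (MVar 2))
        (MThunk (MLam (MApp (MApp (MForce (MVar 2)) (MVar 0)) (MVar 1))))))"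

text \<open>
  The renamings below account for the fresh variables of the translation. In the clause for
  \<open>HOp\<close> the value is moved under \<open>\<lambda>k. \<lambda>h\<close>, and in the return clause of a handler \<open>\<lambda>h\<close> is the
  innermost binder. The body of an operation clause, which refers to \<open>p\<close> and \<open>k\<close> as 1 and 0,
  is moved under \<open>\<lambda>y\<close> and under the variable bound by the case clause, which is then split into
  \<open>p\<close> and \<open>k\<close>; so its indices from 2 on are increased by 2.
  In \<open>translate_handle H R\<close> the argument \<open>R\<close> is the reified translation of the handled computation.
\<close>

primrec translate_val :: "'l hval \<Rightarrow> 'l mval"
  and translate :: "'l hcomp \<Rightarrow> 'l mcomp"
  and translate_handle :: "'l handler \<Rightarrow> 'l mcomp \<Rightarrow> 'l mcomp" where
  "translate_val (HVar n) = MVar n"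
| "translate_val HUnit = MUnit"
| "translate_val (HPair V W) = MPair (translate_val V) (translate_val W)"
| "translate_val (HInj l V) = MInj l (translate_val V)"
| "translate_val (HThunk M) = MThunk (translate M)"
| "translate (HSplit V M) = MSplit (translate_val V) (translate M)"
| "translate (HCase V C) = MCase (translate_val V) (fmmap translate C)"
| "translate (HForce V) = MForce (translate_val V)"
| "translate (HReturn V) = MReturn (translate_val V)"
| "translate (HLet M N) = MLet (translate M) (translate N)"
| "translate (HLam M) = MLam (translate M)"
| "translate (HApp M V) = MApp (translate M) (translate_val V)"
| "translate (HTuple M N) = MTuple (translate M) (translate N)"
| "translate (HPrj1 M) = MPrj1 (translate M)"
| "translate (HPrj2 M) = MPrj2 (translate M)"
| "translate (HOp l V) = MReflect (MLam (MLam (MApp (MForce (MVar 0))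
     (MInj l (MPair
       (mren_val (\<lambda>n. n + 2) (translate_val V))
       (MThunk (MLam (MApp (MApp (MForce (MVar 2)) (MVar 0)) (MVar 1)))))))))"
| "translate (HHandle M H) = translate_handle H (MReify Cont (translate M))"
| "translate_handle (Handler N C) R = MApp (MApp R
     (MThunk (MLam (MLam (mren Suc (translate N))))))
     (MThunk (MLam (MCase (MVar 0)
       (fmmap (\<lambda>M. MSplit (MVar 0) (mren (up_ren (up_ren (\<lambda>n. n + 2))) (translate M))) C))))"

end

theory Submission
  imports Defs
begin

text \<open>
  Reduction in the effect handler calculus takes place only in evaluation contexts, which the
  translation maps to contexts of the target, and the translation commutes with substitution,
  so only the two handler rules need an argument. For these, the unit and the bind of \<open>Cont\<close>
  are applied to the thunks of the return clause and of the operation clauses. The continuation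
  obtained from the bind is \<open>{\<lambda>y. {\<lambda>y. {\<lambda>z. reify \<dots>}! y A}! y B}\<close>, with \<open>A\<close> and \<open>B\<close> these
  thunks; it becomes the translation of the captured continuation only after reduction under
  its binder, which is why \<open>\<leadsto>\<close> has to be closed under all term formers.
\<close>

section \<open>Renaming and substitution\<close>

lemma up_ren_simps [simp]: "up_ren r 0 = 0" "up_ren r (Suc n) = Suc (r n)"
  by (simp_all add: up_ren_def)

lemma mup_simps [simp]: "mup s 0 = MVar 0" "mup s (Suc n) = mren_val Suc (s n)"
  by (simp_all add: mup_def)

lemma up_ren_comp: "(\<lambda>n. up_ren r (up_ren q n)) = up_ren (\<lambda>n. r (q n))"
  by (auto simp: up_ren_def split: nat.split)

lemma mup_up_ren: "(\<lambda>n. mup s (up_ren r n)) = mup (\<lambda>n. s (r n))"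
  by (auto simp: mup_def up_ren_def split: nat.split)

lemma mup_MVar: "mup MVar = MVar"
  by (auto simp: mup_def split: nat.split)

lemma mren_mren:
  fixes V :: "'l mval" and M :: "'l mcomp" and T :: "'l monad"
  shows "mren_val r (mren_val q V) = mren_val (\<lambda>n. r (q n)) V"
  "mren r (mren q M) = mren (\<lambda>n. r (q n)) M"
  "mren_monad r (mren_monad q T) = mren_monad (\<lambda>n. r (q n)) T"
  by (induction V and M and T arbitrary: r q and r q and r q)
    (auto simp: fmap.map_comp up_ren_comp intro!: fmap.map_cong)

lemma msub_mren:
  fixes V :: "'l mval" and M :: "'l mcomp" and T :: "'l monad"
  shows "msub_val s (mren_val r V) = msub_val (\<lambda>n. s (r n)) V"
  "msub s (mren r M) = msub (\<lambda>n. s (r n)) M"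
  "msub_monad s (mren_monad r T) = msub_monad (\<lambda>n. s (r n)) T"
  by (induction V and M and T arbitrary: s r and s r and s r)
    (auto simp: fmap.map_comp mup_up_ren intro!: fmap.map_cong)

lemma mren_mup: "(\<lambda>n. mren_val (up_ren r) (mup s n)) = mup (\<lambda>n. mren_val r (s n))"
  by (rule ext) (auto simp: mup_def mren_mren up_ren_def split: nat.split)

text \<open>The shifts inserted by \<open>translate\<close> have to be moved past substitutions;
  this law and \<open>msub_mren\<close> do so, one for each order of the two operations.\<close>

lemma mren_msub:
  fixes V :: "'l mval" and M :: "'l mcomp" and T :: "'l monad"
  shows "mren_val r (msub_val s V) = msub_val (\<lambda>n. mren_val r (s n)) V"
  "mren r (msub s M) = msub (\<lambda>n. mren_val r (s n)) M"
  "mren_monad r (msub_monad s T) = msub_monad (\<lambda>n. mren_val r (s n)) T"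
  by (induction V and M and T arbitrary: s r and s r and s r)
    (auto simp: fmap.map_comp mren_mup intro!: fmap.map_cong)

lemma fmmap_ident_on: "(\<And>M. M \<in> fmran' C \<Longrightarrow> f M = M) \<Longrightarrow> fmmap f C = C"
  using fmap.map_cong[of C C f id] by (simp add: fmap.map_id)

lemma msub_MVar [simp]:
  fixes V :: "'l mval" and M :: "'l mcomp" and T :: "'l monad"
  shows "msub_val MVar V = V"
  "msub MVar M = M"
  "msub_monad MVar T = T"
  by (induction V and M and T) (auto simp: mup_MVar intro!: fmmap_ident_on)

text \<open>A substitution by variables is a renaming. After a beta step this turns the substitution
  left on a shifted term back into a smaller shift.\<close>

lemma msub_MVar_comp:
  "msub_val (\<lambda>n. MVar (r n)) V = mren_val r V"
  "msub (\<lambda>n. MVar (r n)) M = mren r M"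
  using msub_mren(1)[of MVar r V] msub_mren(2)[of MVar r M] by simp_all

lemma mren_id [simp]: "mren_val (\<lambda>n. n) V = V" "mren (\<lambda>n. n) M = M"
  by (simp_all flip: msub_MVar_comp)

lemma mren_Cont [simp]: "mren_monad r Cont = Cont"
  by (simp add: Cont_def numeral_2_eq_2)

lemma msub_Cont [simp]: "msub_monad s Cont = Cont"
  by (simp add: Cont_def numeral_2_eq_2)

section \<open>The translation commutes with renaming and substitution\<close>

text \<open>\<open>translate_handle\<close> does not inspect \<open>R\<close>, so the third part
  leaves it arbitrary. The case \<open>HHandle\<close> instantiates it with the reified body,
  through which the renaming passes because \<open>Cont\<close> is closed.\<close>

lemma translate_hren:
  fixes V :: "'l hval" and M :: "'l hcomp" and H :: "'l handler"
  shows "translate_val (hren_val r V) = mren_val r (translate_val V)"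
    and "translate (hren r M) = mren r (translate M)"
    and "translate_handle (hren_handler r H) (mren r R) = mren r (translate_handle H R)"
proof (induction V and M and H arbitrary: r and r and r R)
  case (HHandle M H)
  show ?case
    using HHandle(2)[of r "MReify Cont (translate M)"] by (simp add: HHandle(1))
qed (auto simp: fmap.map_comp mren_mren up_ren_comp numeral_2_eq_2 intro!: fmap.map_cong)

lemma translate_hup: "(\<lambda>n. translate_val (hup s n)) = mup (\<lambda>n. translate_val (s n))"
  by (rule ext) (auto simp: hup_def mup_def translate_hren split: nat.split)

lemma translate_hsub:
  fixes V :: "'l hval" and M :: "'l hcomp" and H :: "'l handler"
  shows "translate_val (hsub_val s V) = msub_val (\<lambda>n. translate_val (s n)) (translate_val V)"
    and "translate (hsub s M) = msub (\<lambda>n. translate_val (s n)) (translate M)"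
    and "translate_handle (hsub_handler s H) (msub (\<lambda>n. translate_val (s n)) R)
      = msub (\<lambda>n. translate_val (s n)) (translate_handle H R)"
proof (induction V and M and H arbitrary: s and s and s R)
  case (HHandle M H)
  show ?case
    using HHandle(2)[of s "MReify Cont (translate M)"] by (simp add: HHandle(1))
qed (auto simp: fmap.map_comp translate_hup msub_mren mren_msub mup_up_ren mren_mup mren_mren
       numeral_2_eq_2 intro!: fmap.map_cong)

lemma translate_hinst1: "translate (hinst1 V M) = minst1 (translate_val V) (translate M)"
proof -
  have "(\<lambda>n. translate_val (case_nat V HVar n)) = case_nat (translate_val V) MVar"
    by (auto split: nat.split)
  then show ?thesis
    by (simp add: hinst1_def minst1_def translate_hsub)
qed

lemma translate_hinst2:
  "translate (hinst2 V W M) = minst2 (translate_val V) (translate_val W) (translate M)"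
proof -
  have "(\<lambda>n. translate_val (case_nat W (case_nat V HVar) n))
      = case_nat (translate_val W) (case_nat (translate_val V) MVar)"
    by (auto split: nat.split)
  then show ?thesis
    by (simp add: hinst2_def minst2_def translate_hsub)
qed

primrec translate_frame :: "'l hframe \<Rightarrow> 'l mframe" where
  "translate_frame (HFLet N) = MFLet (translate N)"
| "translate_frame (HFApp V) = MFApp (translate_val V)"
| "translate_frame HFPrj1 = MFPrj1"
| "translate_frame HFPrj2 = MFPrj2"

text \<open>Hoisting contexts consist of core frames only, so their images are again hoisting
  contexts. This is what makes \<open>mbeta_reflect\<close> applicable to the image of a redex of
  \<open>hbeta_op\<close>.\<close>

primrec translate_hoist :: "'l hhoist \<Rightarrow> 'l mhoist" where
  "translate_hoist HHole = MHole"
| "translate_hoist (HHExt X B) = MHExt (translate_hoist X) (translate_frame B)"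

lemma translate_hplug_frame:
  "translate (hplug_frame B M) = mplug_frame (translate_frame B) (translate M)"
  by (cases B) auto

lemma translate_hplug_hoist:
  "translate (hplug_hoist X M) = mplug_hoist (translate_hoist X) (translate M)"
  by (induction X arbitrary: M) (auto simp: translate_hplug_frame)

lemma translate_hren_frame: "translate_frame (hren_frame r B) = mren_frame r (translate_frame B)"
  by (cases B) (auto simp: translate_hren)

lemma translate_hren_hoist: "translate_hoist (hren_hoist r X) = mren_hoist r (translate_hoist X)"
  by (induction X) (auto simp: translate_hren_frame)

section \<open>Congruence\<close>

lemma tranclp_map:
  assumes "r\<^sup>+\<^sup>+ x y" and "\<And>x y. r x y \<Longrightarrow> q (f x) (f y)"
  shows "q\<^sup>+\<^sup>+ (f x) (f y)"
  using assms(1) by induction (auto intro: assms(2) tranclp.trancl_into_trancl)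

lemma mred_beta: "mbeta M N \<Longrightarrow> mred\<^sup>+\<^sup>+ M N"
  by (intro tranclp.r_into_trancl mred_val_mred_mred_monad.intros)

lemmas mred_cong = mred_val_mred_mred_monad.intros(2-)

lemma mred_app: "mred\<^sup>+\<^sup>+ M N \<Longrightarrow> mred\<^sup>+\<^sup>+ (MApp M V) (MApp N V)"
  by (rule tranclp_map[where r = mred and f = "\<lambda>M. MApp M V"]) (auto intro: mred_cong)

lemma mred_beta_app: "minst1 V M = N \<Longrightarrow> mred\<^sup>+\<^sup>+ (MApp (MLam M) V) N"
  using mred_beta[OF mbeta_app] by auto

lemmas mred_beta_force = mred_beta[OF mbeta_force]

text \<open>\<open>hplug\<close> wraps the hole in the innermost frame first, so the induction on
  \<open>K\<close> needs \<open>M\<close> and \<open>N\<close> general.\<close>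

lemma translate_hplug_cong:
  "mred\<^sup>+\<^sup>+ (translate M) (translate N) \<Longrightarrow>
    mred\<^sup>+\<^sup>+ (translate (hplug K M)) (translate (hplug K N))"
proof (induction K arbitrary: M N)
  case HKHole
  then show ?case by simp
next
  case (HKFrame K B)
  have "mred\<^sup>+\<^sup>+ (translate (hplug_frame B M)) (translate (hplug_frame B N))"
    unfolding translate_hplug_frame
    using HKFrame.prems
    by (rule tranclp_map) (cases B; auto intro: mred_cong)
  then show ?case using HKFrame.IH by simp
next
  case (HKHandle K H)
  have "mred\<^sup>+\<^sup>+ (translate (HHandle M H)) (translate (HHandle N H))"
    unfolding translate.simps
    using HKHandle.prems
    \<comment> \<open>The handled computation lies below two applications and a reification: the
      selected rules are those for the function part of \<open>MApp\<close> and the body of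
      \<open>MReify\<close>.\<close>
    by (rule tranclp_map) (cases H; auto intro!: mred_cong(14,22))
  then show ?case using HKHandle.IH by simp
qed

section \<open>Simulation of the handler rules\<close>

text \<open>The unit of \<open>Cont\<close> passes \<open>V\<close> to the thunk of the return
  clause. The inner lambda of that thunk binds the fresh \<open>h\<close>, which the shifted body
  does not mention, so \<open>B\<close> is dropped.\<close>

lemma mred_reify_return:
  "mred\<^sup>+\<^sup>+ (MApp (MApp (MReify Cont (MReturn V)) (MThunk (MLam (MLam (mren Suc N))))) B)
    (minst1 V N)"
proof -
  let ?A = "MThunk (MLam (MLam (mren Suc N)))"
  have "mred\<^sup>+\<^sup>+ (MReify Cont (MReturn V)) (MLam (MApp (MForce (MVar 0)) (mren_val Suc V)))"
    using mred_beta[OF mbeta_ret[of "MLam (MApp (MForce (MVar 0)) (MVar 1))" _ V]]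
    by (simp add: Cont_def minst1_def)
  then have "mred\<^sup>+\<^sup>+ (MApp (MApp (MReify Cont (MReturn V)) ?A) B)
      (MApp (MApp (MLam (MApp (MForce (MVar 0)) (mren_val Suc V))) ?A) B)"
    by (intro mred_app)
  also have "mred\<^sup>+\<^sup>+ \<dots> (MApp (MApp (MForce ?A) V) B)"
    by (intro mred_app mred_beta_app) (simp add: minst1_def msub_mren)
  also have "mred\<^sup>+\<^sup>+ \<dots> (MApp (MApp (MLam (MLam (mren Suc N))) V) B)"
    by (intro mred_app mred_beta_force)
  also have "mred\<^sup>+\<^sup>+ \<dots> (MApp (MLam (mren Suc (minst1 V N))) B)"
    by (intro mred_app mred_beta_app) (simp add: minst1_def msub_mren mren_msub)
  also have "mred\<^sup>+\<^sup>+ \<dots> (minst1 V N)"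
    by (intro mred_beta_app) (simp add: minst1_def[of B] msub_mren)
  finally show ?thesis .
qed

text \<open>The thunk passed to the operation clause is reduced before it is substituted into the
  clause, where it could be duplicated or discarded.\<close>

lemma mred_reify_reflect:
  fixes V A B :: "'l mval" and X :: "'l mhoist"
  defines "E \<equiv> mplug_hoist (mren_hoist Suc X) (MReturn (MVar 0))"
  shows "mred\<^sup>+\<^sup>+
    (MApp (MApp (MReify Cont (mplug_hoist X (MReflect (MLam (MLam (MApp (MForce (MVar 0))
       (MInj l (MPair (mren_val (\<lambda>n. n + 2) V)
         (MThunk (MLam (MApp (MApp (MForce (MVar 2)) (MVar 0)) (MVar 1)))))))))))) A) B)
    (MApp (MForce B) (MInj l (MPair V
      (MThunk (MLam (MApp (MApp (MReify Cont E) (mren_val Suc A)) (mren_val Suc B)))))))"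
proof -
  define R :: "'l mcomp" where "R = MLam (MLam (MApp (MForce (MVar 0))
       (MInj l (MPair (mren_val (\<lambda>n. n + 2) V)
         (MThunk (MLam (MApp (MApp (MForce (MVar 2)) (MVar 0)) (MVar 1))))))))"
  \<comment> \<open>\<open>F\<close> is the continuation captured by \<open>mbeta_reflect\<close>,
    \<open>F2\<close> is \<open>F\<close> below the binders \<open>c\<close> and \<open>y\<close> of
    the bind, and \<open>J\<close> is what \<open>R\<close> receives as \<open>k\<close> once
    \<open>c\<close> is \<open>A\<close>.\<close>
  define F where "F = MThunk (MLam (MReify Cont E))"
  define F2 where "F2 = mren_val (\<lambda>n. Suc (Suc n)) F"
  define J where "J = MThunk (MLam (MApp (MApp (MForce (mren_val Suc F)) (MVar 0)) (mren_val Suc A)))"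
  let ?bind = "MApp (MForce (MThunk (mren Suc R))) (MThunk (MLam (MApp (MApp (MForce F2) (MVar 0)) (MVar 1))))"
  have "minst2 (MThunk R) F (MLam (MApp (MForce (MVar 2))
        (MThunk (MLam (MApp (MApp (MForce (MVar 2)) (MVar 0)) (MVar 1)))))) = MLam ?bind"
    by (simp add: minst2_def mren_mren numeral_2_eq_2 F2_def)
  with mred_beta[OF mbeta_reflect[OF Cont_def, of X R]]
  have "mred\<^sup>+\<^sup>+ (MReify Cont (mplug_hoist X (MReflect R))) (MLam ?bind)"
    by (simp add: F_def E_def)
  then have "mred\<^sup>+\<^sup>+ (MApp (MApp (MReify Cont (mplug_hoist X (MReflect R))) A) B)
      (MApp (MApp (MLam ?bind) A) B)"
    by (intro mred_app)
  also have "mred\<^sup>+\<^sup>+ \<dots> (MApp (MApp (MForce (MThunk R)) J) B)"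
    by (intro mred_app mred_beta_app) (simp add: minst1_def J_def F2_def msub_mren msub_MVar_comp)
  also have "mred\<^sup>+\<^sup>+ \<dots> (MApp (MApp R J) B)"
    by (intro mred_app mred_beta_force)
  also have "mred\<^sup>+\<^sup>+ \<dots> (MApp (MLam (MApp (MForce (MVar 0))
       (MInj l (MPair (mren_val Suc V)
         (MThunk (MLam (MApp (MApp (MForce (mren_val (\<lambda>n. Suc (Suc n)) J)) (MVar 0)) (MVar 1)))))))) B)"
    unfolding R_def
    by (intro mred_app mred_beta_app) (simp add: minst1_def msub_mren mren_mren numeral_2_eq_2 msub_MVar_comp)
  also have "mred\<^sup>+\<^sup>+ \<dots> (MApp (MForce B) (MInj l (MPair V
      (MThunk (MLam (MApp (MApp (MForce (mren_val Suc J)) (MVar 0)) (mren_val Suc B)))))))"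
    by (intro mred_beta_app) (simp add: minst1_def msub_mren msub_MVar_comp)
  also have "mred\<^sup>+\<^sup>+ \<dots> (MApp (MForce B) (MInj l (MPair V
      (MThunk (MLam (MApp (MApp (MReify Cont E) (mren_val Suc A)) (mren_val Suc B)))))))"
  \<comment> \<open>The remaining steps unfold \<open>J\<close> and then \<open>F\<close> under the
    lambda of the resumption; \<open>f\<close> is the context around them.\<close>
  proof (rule tranclp_map[where r = mred and
        f = "\<lambda>M. MApp (MForce B) (MInj l (MPair V (MThunk (MLam (MApp M (mren_val Suc B))))))"])
    have "mren_val Suc J = MThunk (MLam (MApp (MApp (MForce F2) (MVar 0)) (mren_val (\<lambda>n. Suc (Suc n)) A)))"
      by (simp add: J_def F2_def mren_mren)
    then have "mred\<^sup>+\<^sup>+ (MApp (MForce (mren_val Suc J)) (MVar 0))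
       (MApp (MLam (MApp (MApp (MForce F2) (MVar 0)) (mren_val (\<lambda>n. Suc (Suc n)) A))) (MVar 0))"
      by (simp add: mred_app mred_beta_force)
    also have "mred\<^sup>+\<^sup>+ \<dots> (MApp (MApp (MForce (mren_val Suc F)) (MVar 0)) (mren_val Suc A))"
      by (intro mred_beta_app) (simp add: minst1_def msub_mren F2_def msub_MVar_comp)
    also have "mred\<^sup>+\<^sup>+ \<dots>
        (MApp (MApp (MLam (mren (up_ren Suc) (MReify Cont E))) (MVar 0)) (mren_val Suc A))"
      unfolding F_def mren_val.simps mren.simps by (intro mred_app mred_beta_force)
    also have "mred\<^sup>+\<^sup>+ \<dots> (MApp (MReify Cont E) (mren_val Suc A))"
    proof -
      \<comment> \<open>Applying a shifted lambda to \<open>MVar 0\<close> gives back its body: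
        index 0 is kept and the shift of the others is undone.\<close>
      have "(\<lambda>n. case_nat (MVar 0) MVar (up_ren Suc n)) = (MVar :: nat \<Rightarrow> 'l mval)"
        by (auto simp: up_ren_def split: nat.split)
      then show ?thesis
        by (intro mred_app mred_beta_app) (simp add: minst1_def msub_mren)
    qed
    finally show "mred\<^sup>+\<^sup>+ (MApp (MForce (mren_val Suc J)) (MVar 0)) (MApp (MReify Cont E) (mren_val Suc A))" .
  qed (intro mred_cong(15) mred_cong(1-4) mred_cong(13,14))
  finally show ?thesis unfolding R_def .
qed

text \<open>The shift by 2 accounts for \<open>y\<close> and the variable of the case clause. Each
  of the two substitutions removes one of them, so the shift becomes \<open>Suc\<close> and then
  vanishes before the pair is split.\<close>

lemma mred_operation_clause:
  assumes "fmlookup C l = Some M"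
  shows "mred\<^sup>+\<^sup>+
    (MApp (MForce (MThunk (MLam (MCase (MVar 0)
       (fmmap (\<lambda>M. MSplit (MVar 0) (mren (up_ren (up_ren (\<lambda>n. n + 2))) M)) C)))))
      (MInj l (MPair V W)))
    (minst2 V W M)"
proof -
  let ?f = "\<lambda>M. MSplit (MVar 0) (mren (up_ren (up_ren (\<lambda>n. n + 2))) M)"
  let ?g = "\<lambda>M. MSplit (MVar 0) (mren (up_ren (up_ren Suc)) M)"
  \<comment> \<open>The substitution for \<open>y\<close> after the shift by 2 sends
    \<open>n\<close> to \<open>MVar (Suc n)\<close>; lifted below \<open>p\<close> and
    \<open>k\<close> it is the renaming in \<open>?g\<close>.\<close>
  have s: "mup (mup (\<lambda>n. MVar (Suc n))) = (\<lambda>n. MVar (up_ren (up_ren Suc) n))"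
    by (auto simp: mup_def up_ren_def split: nat.split)
  have "mred\<^sup>+\<^sup>+ (MApp (MForce (MThunk (MLam (MCase (MVar 0) (fmmap ?f C))))) (MInj l (MPair V W)))
      (MApp (MLam (MCase (MVar 0) (fmmap ?f C))) (MInj l (MPair V W)))"
    by (intro mred_app mred_beta_force)
  also have "mred\<^sup>+\<^sup>+ \<dots> (MCase (MInj l (MPair V W)) (fmmap ?g C))"
    by (intro mred_beta_app)
      (auto simp: minst1_def fmap.map_comp msub_mren mup_up_ren s msub_MVar_comp intro!: fmap.map_cong)
  also have "mred\<^sup>+\<^sup>+ \<dots> (minst1 (MPair V W) (?g M))"
    using assms by (intro mred_beta mbeta_case) simp
  also have "minst1 (MPair V W) (?g M) = MSplit (MPair V W) M"
    by (simp add: minst1_def msub_mren mup_up_ren mup_MVar)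
  also have "mred\<^sup>+\<^sup>+ \<dots> (minst2 V W M)"
    by (intro mred_beta mbeta_split)
  finally show ?thesis .
qed

lemma translate_hbeta: "hbeta M N \<Longrightarrow> mred\<^sup>+\<^sup>+ (translate M) (translate N)"
proof (induction rule: hbeta.induct)
  case (hbeta_ret V N C)
  show ?case
    using mred_reify_return by (simp add: translate_hinst1)
next
  case (hbeta_op C l M H N X V)
  let ?A = "MThunk (MLam (MLam (mren Suc (translate N))))"
  let ?B = "MThunk (MLam (MCase (MVar 0)
       (fmmap (\<lambda>M. MSplit (MVar 0) (mren (up_ren (up_ren (\<lambda>n. n + 2))) M)) (fmmap translate C))))"
  let ?E = "\<lambda>R. MApp (MApp R ?A) ?B"
  have E: "translate_handle H R = ?E R" for R
    using hbeta_op by (simp add: fmap.map_comp comp_def)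
  let ?k = "HThunk (HLam (HHandle (hplug_hoist (hren_hoist Suc X) (HReturn (HVar 0))) (hren_handler Suc H)))"
  let ?R = "MReify Cont (mplug_hoist (mren_hoist Suc (translate_hoist X)) (MReturn (MVar 0)))"
  have k: "translate_val ?k = MThunk (MLam (MApp (MApp ?R (mren_val Suc ?A)) (mren_val Suc ?B)))"
  proof -
    have "translate_handle (hren_handler Suc H) Q = MApp (MApp Q (mren_val Suc ?A)) (mren_val Suc ?B)" for Q
    proof -
      \<comment> \<open>\<open>translate_hren\<close> speaks of renamed arguments only. A closed
        dummy is its own renaming, and injectivity of \<open>MApp\<close> then yields the two thunks
        for every \<open>Q\<close>.\<close>
      have "translate_handle (hren_handler Suc H) (mren Suc (MReturn MUnit)) = mren Suc (?E (MReturn MUnit))"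
        unfolding translate_hren E ..
      then show ?thesis by (cases H) simp
    qed
    then show ?thesis by (simp add: translate_hplug_hoist translate_hren_hoist)
  qed
  have "fmlookup (fmmap translate C) l = Some (translate M)"
    using hbeta_op by simp
  from mred_operation_clause[OF this, of "translate_val V" "translate_val ?k"]
  have "mred\<^sup>+\<^sup>+ (MApp (MForce ?B) (MInj l (MPair (translate_val V) (translate_val ?k))))
      (translate (hinst2 V ?k M))"
    unfolding translate_hinst2 .
  moreover have "mred\<^sup>+\<^sup>+ (translate (HHandle (hplug_hoist X (HOp l V)) H))
      (MApp (MForce ?B) (MInj l (MPair (translate_val V) (translate_val ?k))))"
    unfolding k translate.simps E translate_hplug_hoist by (rule mred_reify_reflect)
  ultimately show ?case by (rule tranclp_trans[rotated])
qed (auto simp: translate_hinst1 translate_hinst2 intro!: mred_beta mbeta.intros)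

theorem theorem6p9:
  fixes M N :: "'l hcomp"
  assumes "hstep M N"
  shows "mred\<^sup>+\<^sup>+ (translate M) (translate N)"
  using assms by cases (auto intro: translate_hplug_cong translate_hbeta)

end
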